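(* Let $F,G:\mathbb{R}\to\mathbb{R}$ be three times differentiable and let $\phi,\psi:\mathbb{R}\to\mathbb{R}$ be arbitrary functions satisfying $$[F(s+t)-F(s-t)]\,\phi(s)=[G(s+t)-G(s-t)]\,\psi(s)\quad\text{for all } s,t\in\mathbb{R}.$$ Suppose that either $\phi(s)\neq 0$ for all $s\in\mathbb{R}$, or $\psi(s)\neq 0$ for all $s\in\mathbb{R}$. Then one of the following possibilities holds: (a) there exist constants $A_0,A_1,A_2\in\mathbb{R}$, not all zero, such that for all $s\in\mathbb{R}$ we have $A_0+A_1F(s)+A_2G(s)=0$ and $G'(s)\,[A_1\psi(s)+A_2\phi(s)]=0$; (b) there exist constants $A_0,A_1,A_2,B_0,B_1,B_2\in\mathbb{R}$ such that for all $s\in\mathbb{R}$ we have $F(s)=A_0+A_1s+A_2s^2$, $G(s)=B_0+B_1s+B_2s^2$ and $$(A_1+2A_2s)\,\phi(s)=(B_1+2B_2s)\,\psi(s);$$ (c) there exist $\mu\neq 0$ and constants $A_0,A_1,A_2,B_0,B_1,B_2\in\mathbb{R}$ such that for all $s\in\mathbb{R}$ we have $F(s)=A_0+A_1e^{\mu s}+A_2e^{-\mu s}$, $G(s)=B_0+B_1e^{\mu s}+B_2e^{-\mu s}$ and $$(A_1e^{\mu s}-A_2e^{-\mu s})\,\phi(s)=(B_1e^{\mu s}-B_2e^{-\mu s})\,\psi(s);$$ (d) there exist $\mu\neq 0$ and constants $A_0,A_1,A_2,B_0,B_1,B_2\in\mathbb{R}$ such that for all $s\in\mathbb{R}$ we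 have $F(s)=A_0+A_1\sin(\mu s)+A_2\cos(\mu s)$, $G(s)=B_0+B_1\sin(\mu s)+B_2\cos(\mu s)$ and $$[A_1\cos(\mu s)-A_2\sin(\mu s)]\,\phi(s)=[B_1\cos(\mu s)-B_2\sin(\mu s)]\,\psi(s).$$
   Context: The number $\mu$ in (c) and (d) is real. *)

theory Defs
  imports "HOL-Analysis.Analysis"
begin

(* deriv is total, so each of the derivatives of order 0, ..., n - 1 is required to be
   differentiable everywhere; the n-th derivative itself need not be continuous. *)
definition times_differentiable :: "nat \<Rightarrow> (real \<Rightarrow> real) \<Rightarrow> bool" where
  "times_differentiable n f \<longleftrightarrow> (\<forall>k<n. \<forall>x. (deriv ^^ k) f differentiable (at x))"

end

theory Submission
  imports Defs
begin

text \<open>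
  Say \<open>\<phi>\<close> never vanishes and put \<open>h = \<psi> / \<phi>\<close>, \<open>f = F'\<close>, \<open>g = G'\<close>. Differentiating in \<open>t\<close> gives
  \<open>f(s + t) + f(s - t) = h(s) (g(s + t) + g(s - t))\<close>, hence \<open>f = h g\<close>, \<open>f'' = h g''\<close>, and the Wronskian
  \<open>W = f' g - f g'\<close> is constant.
  If \<open>W = 0\<close> and \<open>g(s\<^sub>0) \<noteq> 0\<close>, then \<open>h\<close> is a constant \<open>c\<close> near \<open>s\<^sub>0\<close>, so \<open>f - c g\<close> is odd about every
  point near \<open>s\<^sub>0\<close>; thus it has all small periods and vanishes.
  If \<open>W \<noteq> 0\<close>, then \<open>g\<close> has no zero, \<open>h\<close> is injective since \<open>h' = W / g\<^sup>2\<close>, and comparing the equation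
  with its second \<open>t\<close>-derivative shows that \<open>g'' / g\<close> takes the same value at \<open>s + t\<close> and \<open>s - t\<close>.
  So \<open>f\<close> and \<open>g\<close> solve \<open>y'' = k y\<close> with a constant \<open>k\<close>.
\<close>

lemma times_differentiable_3D:
  assumes "times_differentiable 3 F"
  obtains f f1 f2 where "\<And>x. (F has_real_derivative f x) (at x)"
    and "\<And>x. (f has_real_derivative f1 x) (at x)"
    and "\<And>x. (f1 has_real_derivative f2 x) (at x)"
proof -
  have "((deriv ^^ k) F has_real_derivative (deriv ^^ Suc k) F x) (at x)" if "k < 3" for k x
  proof -
    have "(deriv ^^ k) F differentiable (at x)"
      using assms that by (simp add: times_differentiable_def)
    then show ?thesis
      by (simp add: DERIV_deriv_iff_real_differentiable)
  qed
  from this[of 0] this[of 1] this[of 2] show thesis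
    by (intro that[of "deriv F" "deriv (deriv F)" "deriv (deriv (deriv F))"])
       (simp_all add: numeral_2_eq_2)
qed

section \<open>Explicit solutions of \<open>F''' = k F'\<close> for \<open>k = 0\<close>,
  \<open>k > 0\<close> and \<open>k < 0\<close>\<close>

lemma third_derivative_zero:
  fixes F f f1 :: "real \<Rightarrow> real"
  assumes F: "\<And>x. (F has_real_derivative f x) (at x)"
    and f: "\<And>x. (f has_real_derivative f1 x) (at x)"
    and f1: "\<And>x. (f1 has_real_derivative 0) (at x)"
  obtains A0 A1 A2 where "\<And>s. F s = A0 + A1 * s + A2 * s^2" "\<And>s. f s = A1 + 2 * A2 * s"
proof -
  define A2 where "A2 = f1 0 / 2"
  have 2: "f1 x = 2 * A2" for x
    using DERIV_isconst_all[of f1 x 0] f1 by (auto simp: A2_def)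
  have "((\<lambda>x. f x - 2 * A2 * x) has_real_derivative 0) (at x)" for x
    using 2 by (auto intro!: derivative_eq_intros f)
  then have 1: "f x = f 0 + 2 * A2 * x" for x
    using DERIV_isconst_all[of "\<lambda>x. f x - 2 * A2 * x" x 0] by auto
  have "((\<lambda>x. F x - f 0 * x - A2 * x^2) has_real_derivative 0) (at x)" for x
    using 1[of x] by (auto intro!: derivative_eq_intros F)
  then have "F x = F 0 + f 0 * x + A2 * x^2" for x
    using DERIV_isconst_all[of "\<lambda>x. F x - f 0 * x - A2 * x^2" x 0] by auto
  with 1 show thesis by (rule that[rotated])
qed

text \<open>The constants are found as first integrals. The formula for \<open>f\<close> is recorded
  too, since the relation between \<open>\<phi>\<close> and \<open>\<psi>\<close> is first obtained
  in terms of \<open>F'\<close> and \<open>G'\<close>.\<close>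

lemma third_derivative_exp:
  fixes F f f1 :: "real \<Rightarrow> real"
  assumes F: "\<And>x. (F has_real_derivative f x) (at x)"
    and f: "\<And>x. (f has_real_derivative f1 x) (at x)"
    and f1: "\<And>x. (f1 has_real_derivative \<mu>^2 * f x) (at x)"
    and \<mu>: "\<mu> \<noteq> 0"
  obtains A0 A1 A2 where
    "\<And>s. F s = A0 + A1 * exp (\<mu> * s) + A2 * exp (- (\<mu> * s))"
    "\<And>s. f s = \<mu> * (A1 * exp (\<mu> * s) - A2 * exp (- (\<mu> * s)))"
proof -
  \<comment> \<open>These come from solving the desired formulas for \<open>F\<close>,
    \<open>f\<close> and \<open>f1\<close> for the three coefficients.\<close>
  define a0 where "a0 s = F s - f1 s / \<mu>^2" for s
  define a1 where "a1 s = (f1 s + \<mu> * f s) / (2 * \<mu>^2) * exp (- (\<mu> * s))" for s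
  define a2 where "a2 s = (f1 s - \<mu> * f s) / (2 * \<mu>^2) * exp (\<mu> * s)" for s
  have "(a0 has_real_derivative 0) (at x)" for x
    unfolding a0_def[abs_def] using \<mu>
    by (auto intro!: derivative_eq_intros F f1 simp: field_simps)
  then have 0: "a0 x = a0 0" for x
    using DERIV_isconst_all by blast
  have "(a1 has_real_derivative 0) (at x)" for x
    unfolding a1_def[abs_def] using \<mu>
    by (auto intro!: derivative_eq_intros f f1 simp: field_simps power2_eq_square)
  then have 1: "a1 x = a1 0" for x
    using DERIV_isconst_all by blast
  have "(a2 has_real_derivative 0) (at x)" for x
    unfolding a2_def[abs_def] using \<mu>
    by (auto intro!: derivative_eq_intros f f1 simp: field_simps power2_eq_square)
  then have 2: "a2 x = a2 0" for x
    using DERIV_isconst_all by blast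
  have e1: "a1 s * exp (\<mu> * s) = (f1 s + \<mu> * f s) / (2 * \<mu>^2)" for s
    by (simp add: a1_def exp_minus)
  have e2: "a2 s * exp (- (\<mu> * s)) = (f1 s - \<mu> * f s) / (2 * \<mu>^2)" for s
    by (simp add: a2_def exp_minus)
  show thesis
  proof (rule that)
    show "F s = a0 0 + a1 0 * exp (\<mu> * s) + a2 0 * exp (- (\<mu> * s))" for s
      using e1[of s] e2[of s] 0[of s] 1[of s] 2[of s] \<mu>
      by (simp add: a0_def field_simps)
    show "f s = \<mu> * (a1 0 * exp (\<mu> * s) - a2 0 * exp (- (\<mu> * s)))" for s
      unfolding 1[of s, symmetric] 2[of s, symmetric] e1 e2 using \<mu>
      by (simp add: field_simps power2_eq_square)
  qed
qed

lemma third_derivative_sin_cos: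
  fixes F f f1 :: "real \<Rightarrow> real"
  assumes F: "\<And>x. (F has_real_derivative f x) (at x)"
    and f: "\<And>x. (f has_real_derivative f1 x) (at x)"
    and f1: "\<And>x. (f1 has_real_derivative - (\<mu>^2) * f x) (at x)"
    and \<mu>: "\<mu> \<noteq> 0"
  obtains A0 A1 A2 where
    "\<And>s. F s = A0 + A1 * sin (\<mu> * s) + A2 * cos (\<mu> * s)"
    "\<And>s. f s = \<mu> * (A1 * cos (\<mu> * s) - A2 * sin (\<mu> * s))"
proof -
  \<comment> \<open>The pair \<open>(a1, a2)\<close> is the vector
    \<open>(f / \<mu>, - f1 / \<mu>^2)\<close> rotated by the angle \<open>- \<mu> * s\<close>;
    \<open>e2\<close> and \<open>e1\<close> below rotate it back.\<close>
  define a0 where "a0 s = F s + f1 s / \<mu>^2" for s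
  define a1 where "a1 s = f s / \<mu> * cos (\<mu> * s) - f1 s / \<mu>^2 * sin (\<mu> * s)" for s
  define a2 where "a2 s = - (f s / \<mu> * sin (\<mu> * s)) - f1 s / \<mu>^2 * cos (\<mu> * s)" for s
  have "(a0 has_real_derivative 0) (at x)" for x
    unfolding a0_def[abs_def] using \<mu>
    by (auto intro!: derivative_eq_intros F f1 simp: field_simps)
  then have 0: "a0 x = a0 0" for x
    using DERIV_isconst_all by blast
  have "(a1 has_real_derivative 0) (at x)" for x
    unfolding a1_def[abs_def] using \<mu>
    by (auto intro!: derivative_eq_intros f f1 simp: field_simps power2_eq_square)
  then have 1: "a1 x = a1 0" for x
    using DERIV_isconst_all by blast
  have "(a2 has_real_derivative 0) (at x)" for x
    unfolding a2_def[abs_def] using \<mu>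
    by (auto intro!: derivative_eq_intros f f1 simp: field_simps power2_eq_square)
  then have 2: "a2 x = a2 0" for x
    using DERIV_isconst_all by blast
  have sc: "sin (\<mu> * s) * sin (\<mu> * s) = 1 - cos (\<mu> * s) * cos (\<mu> * s)" for s
    using sin_cos_squared_add[of "\<mu> * s"] by (simp add: power2_eq_square)
  have e1: "a1 s * sin (\<mu> * s) + a2 s * cos (\<mu> * s) = - f1 s / \<mu>^2" for s
  proof -
    have "a1 s * sin (\<mu> * s) + a2 s * cos (\<mu> * s)
        = - (f1 s / \<mu>^2) * (sin (\<mu> * s) * sin (\<mu> * s) + cos (\<mu> * s) * cos (\<mu> * s))"
      unfolding a1_def a2_def by algebra
    then show ?thesis by (simp add: sc)
  qed
  have e2: "a1 s * cos (\<mu> * s) - a2 s * sin (\<mu> * s) = f s / \<mu>" for s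
  proof -
    have "a1 s * cos (\<mu> * s) - a2 s * sin (\<mu> * s)
        = f s / \<mu> * (sin (\<mu> * s) * sin (\<mu> * s) + cos (\<mu> * s) * cos (\<mu> * s))"
      unfolding a1_def a2_def by algebra
    then show ?thesis by (simp add: sc)
  qed
  show thesis
  proof (rule that)
    show "F s = a0 0 + a1 0 * sin (\<mu> * s) + a2 0 * cos (\<mu> * s)" for s
      using e1[of s] 0[of s] 1[of s] 2[of s] by (simp add: a0_def)
    show "f s = \<mu> * (a1 0 * cos (\<mu> * s) - a2 0 * sin (\<mu> * s))" for s
      using e2[of s] 1[of s] 2[of s] \<mu> by simp
  qed
qed

section \<open>The functional equation: proportional derivatives or a common linear equation\<close>

lemma DERIV_add_arg:
  fixes u v :: "real \<Rightarrow> real"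
  assumes "\<And>x. (u has_real_derivative v x) (at x)"
  shows "((\<lambda>t. u (s + t)) has_real_derivative v (s + t)) (at t)"
proof -
  have "((\<lambda>t. u (s + t)) has_real_derivative v (s + t) * 1) (at t)"
    by (rule DERIV_chain2[where f = u]) (auto intro!: assms derivative_eq_intros)
  then show ?thesis by simp
qed

lemma DERIV_diff_arg:
  fixes u v :: "real \<Rightarrow> real"
  assumes "\<And>x. (u has_real_derivative v x) (at x)"
  shows "((\<lambda>t. u (s - t)) has_real_derivative - v (s - t)) (at t)"
proof -
  have "((\<lambda>t. u (s - t)) has_real_derivative v (s - t) * - 1) (at t)"
    by (rule DERIV_chain2[where f = u]) (auto intro!: assms derivative_eq_intros)
  then show ?thesis by simp
qed

text \<open>The two alternatives come from a vanishing and a nonvanishing Wronskian. No regularity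
  is assumed of \<open>h\<close>, which stands for \<open>\<psi> / \<phi>\<close> or, with
  \<open>F\<close> and \<open>G\<close> exchanged, for \<open>\<phi> / \<psi>\<close>.\<close>

lemma proportional_or_common_linear_ode:
  fixes F G f g f1 g1 f2 g2 h :: "real \<Rightarrow> real"
  assumes F: "\<And>x. (F has_real_derivative f x) (at x)"
    and f: "\<And>x. (f has_real_derivative f1 x) (at x)"
    and f1: "\<And>x. (f1 has_real_derivative f2 x) (at x)"
    and G: "\<And>x. (G has_real_derivative g x) (at x)"
    and g: "\<And>x. (g has_real_derivative g1 x) (at x)"
    and g1: "\<And>x. (g1 has_real_derivative g2 x) (at x)"
    and eq: "\<And>s t. F (s + t) - F (s - t) = h s * (G (s + t) - G (s - t))"
  shows "(\<exists>c. \<forall>s. f s = c * g s) \<or> (\<exists>k. \<forall>s. f2 s = k * f s \<and> g2 s = k * g s)"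
proof -
  \<comment> \<open>All differentiations are in \<open>t\<close> with \<open>s\<close> fixed, so
    \<open>h s\<close> is a constant factor.\<close>
  have eq0: "f (s + t) + f (s - t) = h s * (g (s + t) + g (s - t))" for s t
  proof (rule DERIV_unique)
    show "((\<lambda>t. F (s + t) - F (s - t)) has_real_derivative f (s + t) + f (s - t)) (at t)"
      using DERIV_diff[OF DERIV_add_arg[OF F] DERIV_diff_arg[OF F]] by simp
    show "((\<lambda>t. F (s + t) - F (s - t)) has_real_derivative
        h s * (g (s + t) + g (s - t))) (at t)"
      unfolding eq using DERIV_cmult[OF DERIV_diff[OF DERIV_add_arg[OF G] DERIV_diff_arg[OF G]]] by simp
  qed
  have eq1: "f1 (s + t) - f1 (s - t) = h s * (g1 (s + t) - g1 (s - t))" for s t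
  proof (rule DERIV_unique)
    show "((\<lambda>t. f (s + t) + f (s - t)) has_real_derivative f1 (s + t) - f1 (s - t)) (at t)"
      using DERIV_add[OF DERIV_add_arg[OF f] DERIV_diff_arg[OF f]] by simp
    show "((\<lambda>t. f (s + t) + f (s - t)) has_real_derivative
        h s * (g1 (s + t) - g1 (s - t))) (at t)"
      unfolding eq0 using DERIV_cmult[OF DERIV_add[OF DERIV_add_arg[OF g] DERIV_diff_arg[OF g]]] by simp
  qed
  have eq2: "f2 (s + t) + f2 (s - t) = h s * (g2 (s + t) + g2 (s - t))" for s t
  proof (rule DERIV_unique)
    show "((\<lambda>t. f1 (s + t) - f1 (s - t)) has_real_derivative f2 (s + t) + f2 (s - t)) (at t)"
      using DERIV_diff[OF DERIV_add_arg[OF f1] DERIV_diff_arg[OF f1]] by simp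
    show "((\<lambda>t. f1 (s + t) - f1 (s - t)) has_real_derivative
        h s * (g2 (s + t) + g2 (s - t))) (at t)"
      unfolding eq1 using DERIV_cmult[OF DERIV_diff[OF DERIV_add_arg[OF g1] DERIV_diff_arg[OF g1]]] by simp
  qed
  have fh: "f s = h s * g s" for s
    using eq0[of s 0] by simp
  have f2h: "f2 s = h s * g2 s" for s
    using eq2[of s 0] by simp
  define W where "W s = f1 s * g s - f s * g1 s" for s
  \<comment> \<open>Both sides equal \<open>h x * g x * g2 x\<close>, and their difference is the
    derivative of \<open>W\<close>.\<close>
  have "f2 x * g x = f x * g2 x" for x
    by (simp add: fh[of x] f2h[of x])
  then have "(W has_real_derivative 0) (at x)" for x
    unfolding W_def[abs_def] by (auto intro!: derivative_eq_intros f g f1 g1)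
  then have W_const: "W x = W 0" for x
    using DERIV_isconst_all by blast
  have quot: "((\<lambda>x. f x / g x) has_real_derivative W 0 / (g x)^2) (at x)" if "g x \<noteq> 0" for x
    using W_const[of x] that
    by (auto intro!: derivative_eq_intros f g simp: W_def power2_eq_square)
  show ?thesis
  proof (cases "W 0 = 0")
    case True
    show ?thesis
    proof (cases "\<forall>s. g s = 0")
      case True
      then show ?thesis by (simp add: fh)
    next
      case False
      then obtain s0 where s0: "g s0 \<noteq> 0" by blast
      obtain d where d: "d > 0" "\<And>x. x \<in> ball s0 d \<Longrightarrow> g x \<noteq> 0"
        using continuous_at_avoid[OF DERIV_isCont[OF g] s0] by auto
      define c where "c = h s0"
      \<comment> \<open>Where \<open>g\<close> has no zero, \<open>h\<close> is
        \<open>f / g\<close>, whose derivative \<open>W 0 / g^2\<close> vanishes here; the ball is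
        convex.\<close>
      have hc: "h x = c" if x: "x \<in> ball s0 d" for x
      proof -
        have "\<exists>e. \<forall>y\<in>ball s0 d. f y / g y = e"
        proof (rule has_field_derivative_zero_constant)
          show "((\<lambda>x. f x / g x) has_real_derivative 0) (at y within ball s0 d)"
            if "y \<in> ball s0 d" for y
            using quot[OF d(2)[OF that]] True by (simp add: has_field_derivative_at_within)
        qed simp
        then have "f x / g x = f s0 / g s0"
          using x d(1) by force
        then show ?thesis
          using d(2)[OF x] s0 by (simp add: fh c_def)
      qed
      define p where "p x = f x - c * g x" for x
      have p: "p (s + t) = - p (s - t)" if "s \<in> ball s0 d" for s t
        using eq0[of s t] hc[OF that] by (simp add: p_def algebra_simps)
      \<comment> \<open>Reflecting \<open>x\<close> in \<open>s0\<close> and then in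
        \<open>s0 + e\<close> translates it by \<open>2 * e = y - x\<close>. Both centres lie in the
        ball, and the two sign changes cancel.\<close>
      have period: "p y = p x" if "\<bar>x - y\<bar> < d" for x y
      proof -
        define e where "e = (y - x) / 2"
        have "p x = - p (2 * s0 - x)"
          using p[of s0 "x - s0"] d(1) by simp
        also have "\<dots> = p y"
        proof -
          have "s0 + e \<in> ball s0 d"
            using that d(1) by (simp add: e_def dist_real_def)
          moreover have "s0 + e - (y - s0 - e) = 2 * s0 - x"
            by (simp add: e_def field_simps)
          ultimately show ?thesis
            using p[of "s0 + e" "y - s0 - e"] by simp
        qed
        finally show ?thesis by simp
      qed
      have "(p has_real_derivative f1 x - c * g1 x) (at x)" for x
        unfolding p_def[abs_def] by (auto intro!: derivative_eq_intros f g)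
      \<comment> \<open>By \<open>period\<close>, \<open>p\<close> is constant on a neighbourhood of
        every point, so its derivative vanishes.\<close>
      moreover from this have "f1 x - c * g1 x = 0" for x
        using DERIV_local_const[of p _ x d] d(1) period by metis
      ultimately have "(p has_real_derivative 0) (at x)" for x
        by metis
      then have "p x = p s0" for x
        using DERIV_isconst_all by blast
      \<comment> \<open>The constant value of \<open>p\<close> is \<open>p s0 = 0\<close>, because
        \<open>c = h s0\<close>.\<close>
      then have "f x = c * g x" for x
        by (simp add: p_def fh c_def)
      then show ?thesis by blast
    qed
  next
    case False
    \<comment> \<open>At a zero of \<open>g\<close>, \<open>f = h g\<close> would vanish as well,
      and with it \<open>W\<close>.\<close>
    have g0: "g x \<noteq> 0" for x
      using False W_const[of x] by (auto simp: W_def fh)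
    have h': "(h has_real_derivative W 0 / (g x)^2) (at x)" for x
    proof -
      have "h = (\<lambda>x. f x / g x)"
        using g0 by (simp add: fh fun_eq_iff)
      then show ?thesis
        using quot[OF g0] by simp
    qed
    \<comment> \<open>By the mean value theorem, since the derivative of \<open>h\<close> is nowhere
      zero.\<close>
    have inj: "h a \<noteq> h b" if "a < b" for a b
      using MVT2[OF that h'] False g0 that by auto
    have "g2 x / g x = g2 0 / g 0" for x
    proof (cases "x = 0")
      case False
      \<comment> \<open>Taking \<open>t = s = x / 2\<close> makes the two arguments \<open>x\<close>
        and \<open>0\<close>. Then \<open>g\<close> and \<open>g2\<close> satisfy the same linear
        relation between their values there, and its coefficient \<open>h x - h s\<close> is nonzero
        by injectivity.\<close>
      define s where "s = x / 2"
      have 1: "(h x - h s) * g x = (h s - h 0) * g 0"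
        using eq0[of s s] by (simp add: s_def fh algebra_simps)
      have 2: "(h x - h s) * g2 x = (h s - h 0) * g2 0"
        using eq2[of s s] by (simp add: s_def f2h algebra_simps)
      have "h x \<noteq> h s"
        using inj[of x s] inj[of s x] False by (cases "x < 0") (auto simp: s_def)
      moreover have "(h x - h s) * (g2 x * g 0) = (h x - h s) * (g2 0 * g x)"
        using 1 2 by algebra
      ultimately show ?thesis
        using g0 by (simp add: frac_eq_eq)
    qed simp
    then have "g2 x = g2 0 / g 0 * g x" for x
      using g0[of x] by (metis nonzero_eq_divide_eq)
    then have "\<forall>s. f2 s = g2 0 / g 0 * f s \<and> g2 s = g2 0 / g 0 * g s"
      by (metis f2h fh mult.left_commute)
    then show ?thesis by blast
  qed
qed

section \<open>Assembling the four possibilities\<close>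

theorem theorem12:
  fixes F G \<phi> \<psi> :: "real \<Rightarrow> real"
  assumes "times_differentiable 3 F" and "times_differentiable 3 G"
    and "\<forall>s t. (F (s + t) - F (s - t)) * \<phi> s = (G (s + t) - G (s - t)) * \<psi> s"
    and "(\<forall>s. \<phi> s \<noteq> 0) \<or> (\<forall>s. \<psi> s \<noteq> 0)"
  shows
    "(\<exists>A0 A1 A2 :: real. \<not> (A0 = 0 \<and> A1 = 0 \<and> A2 = 0) \<and>
        (\<forall>s. A0 + A1 * F s + A2 * G s = 0 \<and>
             deriv G s * (A1 * \<psi> s + A2 * \<phi> s) = 0))
   \<or> (\<exists>A0 A1 A2 B0 B1 B2 :: real. \<forall>s.
        F s = A0 + A1 * s + A2 * s^2 \<and>
        G s = B0 + B1 * s + B2 * s^2 \<and>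
        (A1 + 2 * A2 * s) * \<phi> s = (B1 + 2 * B2 * s) * \<psi> s)
   \<or> (\<exists>\<mu> A0 A1 A2 B0 B1 B2 :: real. \<mu> \<noteq> 0 \<and> (\<forall>s.
        F s = A0 + A1 * exp (\<mu> * s) + A2 * exp (- (\<mu> * s)) \<and>
        G s = B0 + B1 * exp (\<mu> * s) + B2 * exp (- (\<mu> * s)) \<and>
        (A1 * exp (\<mu> * s) - A2 * exp (- (\<mu> * s))) * \<phi> s =
        (B1 * exp (\<mu> * s) - B2 * exp (- (\<mu> * s))) * \<psi> s))
   \<or> (\<exists>\<mu> A0 A1 A2 B0 B1 B2 :: real. \<mu> \<noteq> 0 \<and> (\<forall>s.
        F s = A0 + A1 * sin (\<mu> * s) + A2 * cos (\<mu> * s) \<and>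
        G s = B0 + B1 * sin (\<mu> * s) + B2 * cos (\<mu> * s) \<and>
        (A1 * cos (\<mu> * s) - A2 * sin (\<mu> * s)) * \<phi> s =
        (B1 * cos (\<mu> * s) - B2 * sin (\<mu> * s)) * \<psi> s))"
proof -
  from assms(1) obtain f f1 f2 where F: "\<And>x. (F has_real_derivative f x) (at x)"
    and f: "\<And>x. (f has_real_derivative f1 x) (at x)"
    and f1: "\<And>x. (f1 has_real_derivative f2 x) (at x)"
    by (rule times_differentiable_3D) blast
  from assms(2) obtain g g1 g2 where G: "\<And>x. (G has_real_derivative g x) (at x)"
    and g: "\<And>x. (g has_real_derivative g1 x) (at x)"
    and g1: "\<And>x. (g1 has_real_derivative g2 x) (at x)"
    by (rule times_differentiable_3D) blast
  \<comment> \<open>The \<open>t\<close>-derivative at \<open>0\<close> of half the functional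
    equation. It supplies the relation between \<open>\<phi>\<close> and \<open>\<psi>\<close> in
    all four possibilities.\<close>
  have fg: "f s * \<phi> s = g s * \<psi> s" for s
  proof (rule DERIV_unique)
    have sym: "((\<lambda>t. u (s + t) - u (s - t)) has_real_derivative 2 * v s) (at 0)"
      if "\<And>x. (u has_real_derivative v x) (at x)" for u v :: "real \<Rightarrow> real"
      using DERIV_diff[OF DERIV_add_arg[OF that, of s 0] DERIV_diff_arg[OF that, of s 0]] by simp
    show "((\<lambda>t. (F (s + t) - F (s - t)) / 2 * \<phi> s) has_real_derivative f s * \<phi> s) (at 0)"
      using DERIV_cmult_right[OF DERIV_cdivide[OF sym[OF F], of 2], of "\<phi> s"] by simp
    have "(\<lambda>t. (F (s + t) - F (s - t)) / 2 * \<phi> s) = (\<lambda>t. (G (s + t) - G (s - t)) / 2 * \<psi> s)"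
      using assms(3) by auto
    then show "((\<lambda>t. (F (s + t) - F (s - t)) / 2 * \<phi> s) has_real_derivative g s * \<psi> s) (at 0)"
      using DERIV_cmult_right[OF DERIV_cdivide[OF sym[OF G], of 2], of "\<psi> s"] by simp
  qed
  have dG: "deriv G s = g s" for s
    using G DERIV_imp_deriv by blast
  \<comment> \<open>Proportionality arises in a direction that depends on which of
    \<open>\<phi>\<close>, \<open>\<psi>\<close> has no zero; the alternative \<open>ode\<close> is
    symmetric in \<open>F\<close> and \<open>G\<close>.\<close>
  from assms(4) consider
      (F_prop) c where "\<And>s. f s = c * g s" "\<And>s. \<phi> s \<noteq> 0"
    | (G_prop) c where "\<And>s. g s = c * f s" "\<And>s. \<psi> s \<noteq> 0"
    | (ode) k where "\<And>s. f2 s = k * f s" "\<And>s. g2 s = k * g s"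
  proof
    assume nz: "\<forall>s. \<phi> s \<noteq> 0"
    have "F (s + t) - F (s - t) = (\<psi> s / \<phi> s) * (G (s + t) - G (s - t))" for s t
      using assms(3)[rule_format, of s t] nz by (simp add: field_simps)
    from proportional_or_common_linear_ode[OF F f f1 G g g1 this] show thesis
      using nz that(1,3) by blast
  next
    assume nz: "\<forall>s. \<psi> s \<noteq> 0"
    have "G (s + t) - G (s - t) = (\<phi> s / \<psi> s) * (F (s + t) - F (s - t))" for s t
      using assms(3)[rule_format, of s t] nz by (simp add: field_simps)
    from proportional_or_common_linear_ode[OF G g g1 F f f1 this] show thesis
      using nz that(2,3) by blast
  qed
  then show ?thesis
  proof cases
    case F_prop
    have "((\<lambda>x. F x - c * G x) has_real_derivative 0) (at x)" for x
      by (auto intro!: derivative_eq_intros F G simp: F_prop(1))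
    then have "F x - c * G x = F 0 - c * G 0" for x
      using DERIV_isconst_all[of "\<lambda>x. F x - c * G x" x 0] by blast
    \<comment> \<open>The second equation is \<open>fg\<close>, as \<open>c * g s = f s\<close>. The
      coefficient \<open>1\<close> of \<open>F\<close> makes the triple nonzero.\<close>
    then have "- (F 0 - c * G 0) + 1 * F s + (- c) * G s = 0 \<and>
        deriv G s * (1 * \<psi> s + (- c) * \<phi> s) = 0" for s
      using fg[of s] by (auto simp: F_prop(1) dG algebra_simps)
    then show ?thesis
      by (intro disjI1 exI[of _ "- (F 0 - c * G 0)"] exI[of _ 1] exI[of _ "- c"]) simp
  next
    case G_prop
    have "((\<lambda>x. G x - c * F x) has_real_derivative 0) (at x)" for x
      by (auto intro!: derivative_eq_intros F G simp: G_prop(1))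
    then have "G x - c * F x = G 0 - c * F 0" for x
      using DERIV_isconst_all[of "\<lambda>x. G x - c * F x" x 0] by blast
    \<comment> \<open>Possibility (a) has the factor \<open>G'\<close> in this case too, so
      exchanging the roles in the previous argument is not enough; substituting
      \<open>g = c f\<close> in one term reduces the claim to \<open>c\<close> times
      \<open>fg\<close>.\<close>
    moreover have "g s * (- c * \<psi> s + \<phi> s) = 0" for s
    proof -
      have "g s * (- c * \<psi> s + \<phi> s) = c * (f s * \<phi> s - g s * \<psi> s)"
        by (simp add: G_prop(1) algebra_simps)
      then show ?thesis by (simp add: fg)
    qed
    ultimately have "- (G 0 - c * F 0) + (- c) * F s + 1 * G s = 0 \<and>
        deriv G s * ((- c) * \<psi> s + 1 * \<phi> s) = 0" for s
      by (simp add: dG algebra_simps)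
    then show ?thesis
      by (intro disjI1 exI[of _ "- (G 0 - c * F 0)"] exI[of _ "- c"] exI[of _ 1]) simp
  next
    case ode
    \<comment> \<open>The sign of \<open>k\<close> decides between (b), (c) and (d), with
      \<open>\<mu>\<close> the square root of \<open>k\<close> or of \<open>- k\<close>.\<close>
    consider "k = 0" | "k > 0" | "k < 0" by linarith
    then show ?thesis
    proof cases
      case 1
      then have z: "\<And>x. (f1 has_real_derivative 0) (at x)" "\<And>x. (g1 has_real_derivative 0) (at x)"
        using f1 g1 ode by simp_all
      obtain A0 A1 A2 where A: "\<And>s. F s = A0 + A1 * s + A2 * s^2" "\<And>s. f s = A1 + 2 * A2 * s"
        using third_derivative_zero[OF F f z(1)] by blast
      obtain B0 B1 B2 where B: "\<And>s. G s = B0 + B1 * s + B2 * s^2" "\<And>s. g s = B1 + 2 * B2 * s"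
        using third_derivative_zero[OF G g z(2)] by blast
      show ?thesis
        by (rule disjI2, rule disjI1, intro exI allI conjI)
          (rule A(1) B(1) fg[unfolded A(2) B(2)])+
    next
      case 2
      define \<mu> where "\<mu> = sqrt k"
      have \<mu>: "\<mu> \<noteq> 0" "k = \<mu>^2"
        using 2 by (simp_all add: \<mu>_def)
      have e: "\<And>x. (f1 has_real_derivative \<mu>^2 * f x) (at x)"
          "\<And>x. (g1 has_real_derivative \<mu>^2 * g x) (at x)"
        using f1 g1 ode \<mu>(2) by simp_all
      obtain A0 A1 A2 where A:
          "\<And>s. F s = A0 + A1 * exp (\<mu> * s) + A2 * exp (- (\<mu> * s))"
          "\<And>s. f s = \<mu> * (A1 * exp (\<mu> * s) - A2 * exp (- (\<mu> * s)))"
        using third_derivative_exp[OF F f e(1) \<mu>(1)] by blast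
      obtain B0 B1 B2 where B:
          "\<And>s. G s = B0 + B1 * exp (\<mu> * s) + B2 * exp (- (\<mu> * s))"
          "\<And>s. g s = \<mu> * (B1 * exp (\<mu> * s) - B2 * exp (- (\<mu> * s)))"
        using third_derivative_exp[OF G g e(2) \<mu>(1)] by blast
      \<comment> \<open>This is \<open>fg\<close> after cancelling the common factor
        \<open>\<mu>\<close>.\<close>
      have C: "(A1 * exp (\<mu> * s) - A2 * exp (- (\<mu> * s))) * \<phi> s =
          (B1 * exp (\<mu> * s) - B2 * exp (- (\<mu> * s))) * \<psi> s" for s
        using fg[of s] \<mu>(1) unfolding A(2) B(2) mult.assoc by simp
      show ?thesis
        by (rule disjI2, rule disjI2, rule disjI1, intro exI conjI allI) (rule \<mu>(1) A(1) B(1) C)+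
    next
      case 3
      define \<mu> where "\<mu> = sqrt (- k)"
      have \<mu>: "\<mu> \<noteq> 0" "k = - (\<mu>^2)"
        using 3 by (simp_all add: \<mu>_def)
      have e: "\<And>x. (f1 has_real_derivative - (\<mu>^2) * f x) (at x)"
          "\<And>x. (g1 has_real_derivative - (\<mu>^2) * g x) (at x)"
        using f1 g1 unfolding ode \<mu>(2) by simp_all
      obtain A0 A1 A2 where A:
          "\<And>s. F s = A0 + A1 * sin (\<mu> * s) + A2 * cos (\<mu> * s)"
          "\<And>s. f s = \<mu> * (A1 * cos (\<mu> * s) - A2 * sin (\<mu> * s))"
        using third_derivative_sin_cos[OF F f e(1) \<mu>(1)] by blast
      obtain B0 B1 B2 where B:
          "\<And>s. G s = B0 + B1 * sin (\<mu> * s) + B2 * cos (\<mu> * s)"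
          "\<And>s. g s = \<mu> * (B1 * cos (\<mu> * s) - B2 * sin (\<mu> * s))"
        using third_derivative_sin_cos[OF G g e(2) \<mu>(1)] by blast
      have C: "(A1 * cos (\<mu> * s) - A2 * sin (\<mu> * s)) * \<phi> s =
          (B1 * cos (\<mu> * s) - B2 * sin (\<mu> * s)) * \<psi> s" for s
        using fg[of s] \<mu>(1) unfolding A(2) B(2) mult.assoc by simp
      show ?thesis
        by (rule disjI2, rule disjI2, rule disjI2, intro exI conjI allI) (rule \<mu>(1) A(1) B(1) C)+
    qed
  qed
qed

end
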